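(* Let $A,E\in\mathbb{R}^{n\times n}$, $B\in\mathbb{R}^{n\times n_{\rm in}}$, $C\in\mathbb{R}^{n_{\rm out}\times n}$, where $E$ is singular and the matrix pencil $(E,A)$ is regular. Assume that the differential-algebraic system $$E\dot{x}(t)=Ax(t)+Bu(t),\qquad y(t)=Cx(t)$$ is asymptotically stable and that its transfer function $H_{\rm DAE}(s)=C(sE-A)^{-1}B$ is strictly proper. For $\beta>0$ put $\alpha=\beta^2$ and $$\hat{E}=E-\alpha A,\qquad \hat{A}=A+\beta E,$$ and let $H_{\rm ODE}(s)=C(s\hat{E}-\hat{A})^{-1}B$ be the transfer function of the resulting system of ordinary differential equations $\hat{E}\dot{x}=\hat{A}x+Bu$, $y=Cx$. Then for each $\varepsilon>0$ there is a constant $L>0$ such that $$\|H_{\rm DAE}-H_{\rm ODE}\|_{\mathcal{H}_2}<\varepsilon$$ for all parameters $\beta$ with $0<\beta<L$.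
   Context: A matrix pencil $(E,A)$ is regular if $\det(\lambda E-A)\neq 0$ for some $\lambda\in\mathbb{C}$. The system is asymptotically stable if the pencil $(E,A)$ is stable, i.e., every $\lambda\in\mathbb{C}$ with $\det(\lambda E-A)=0$ has strictly negative real part. A transfer function $H$ is strictly proper if $\lim_{s\to\infty}H(s)=0$. The $\mathcal{H}_2$-norm is $$\|H\|_{\mathcal{H}_2}=\sqrt{\frac{1}{2\pi}\int_{-\infty}^{+\infty}\|H(\mathrm{i}\omega)\|_{\rm F}^2\,\mathrm{d}\omega},$$ with the Frobenius norm $\|\cdot\|_{\rm F}$, provided that the integral exists. For stable $(E,A)$ the matrix $\hat{E}$ is non-singular for all $\alpha>0$. *)

theory Defs
  imports "HOL-Analysis.Analysis"
begin

definition pencil :: "real^'n^'n \<Rightarrow> real^'n^'n \<Rightarrow> complex \<Rightarrow> complex^'n^'n" where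
  "pencil E A s = (\<chi> i j. s * complex_of_real (E $ i $ j) - complex_of_real (A $ i $ j))"

definition regular_pencil :: "real^'n^'n \<Rightarrow> real^'n^'n \<Rightarrow> bool" where
  "regular_pencil E A \<longleftrightarrow> (\<exists>s. det (pencil E A s) \<noteq> 0)"

definition stable_pencil :: "real^'n^'n \<Rightarrow> real^'n^'n \<Rightarrow> bool" where
  "stable_pencil E A \<longleftrightarrow> (\<forall>s. det (pencil E A s) = 0 \<longrightarrow> Re s < 0)"

(* At eigenvalues of the pencil, matrix_inv and hence the transfer function are unspecified.
   For a regular pencil this concerns only finitely many s. *)
definition transfer_function ::
    "real^'n^'n \<Rightarrow> real^'n^'n \<Rightarrow> real^'m^'n \<Rightarrow> real^'n^'p \<Rightarrow> complex \<Rightarrow> complex^'m^'p" where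
  "transfer_function E A B C s =
     map_matrix complex_of_real C ** matrix_inv (pencil E A s) ** map_matrix complex_of_real B"

definition strictly_proper :: "(complex \<Rightarrow> complex^'m^'p) \<Rightarrow> bool" where
  "strictly_proper H \<longleftrightarrow> (H \<longlongrightarrow> 0) at_infinity"

definition frobenius_norm :: "complex^'m^'p \<Rightarrow> real" where
  "frobenius_norm M = sqrt (\<Sum>i\<in>UNIV. \<Sum>j\<in>UNIV. (cmod (M $ i $ j))\<^sup>2)"

lemma frobenius_norm_eq_norm: "frobenius_norm M = norm M"
  by (simp add: frobenius_norm_def norm_vec_def L2_set_def sum_nonneg)

definition h2_norm_exists :: "(complex \<Rightarrow> complex^'m^'p) \<Rightarrow> bool" where
  "h2_norm_exists H \<longleftrightarrow>
     integrable lborel (\<lambda>\<omega>::real. (frobenius_norm (H (\<i> * complex_of_real \<omega>)))\<^sup>2)"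

(* Only meaningful if h2_norm_exists H: the Bochner integral of a non-integrable function is 0. *)
definition h2_norm :: "(complex \<Rightarrow> complex^'m^'p) \<Rightarrow> real" where
  "h2_norm H =
     sqrt (1 / (2 * pi) * (LINT \<omega>|lborel. (frobenius_norm (H (\<i> * complex_of_real \<omega>)))\<^sup>2))"

end

theory Submission
  imports Defs "HOL-Probability.Sinc_Integral"
begin

text \<open>Since \<open>s(E - \<beta>\<^sup>2A) - (A + \<beta>E) = (1 + \<beta>\<^sup>2s)(zE - A)\<close> with
  \<open>z = (s - \<beta>) / (1 + \<beta>\<^sup>2s)\<close>, the regularised transfer function is
  \<open>H\<^sub>O\<^sub>D\<^sub>E(s) = H\<^sub>D\<^sub>A\<^sub>E(z) / (1 + \<beta>\<^sup>2s)\<close>, and for imaginary \<open>s\<close> the point \<open>z\<close> satisfies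
  \<open>Re z \<ge> -\<beta>\<close>. The entries of \<open>H\<^sub>D\<^sub>A\<^sub>E\<close> are rational, vanish at infinity and have all poles in an
  open left half-plane \<open>Re z < -\<delta>\<close>, so \<open>|H\<^sub>D\<^sub>A\<^sub>E(z)| \<le> K / (1 + |z|)\<close> for \<open>Re z \<ge> -\<delta>\<close>. Because
  \<open>|1 + \<beta>\<^sup>2s|(1 + |z|) = |1 + \<beta>\<^sup>2s| + |s - \<beta>| \<ge> 1 + |s|\<close> on the imaginary axis, both
  transfer functions have the square-integrable majorant \<open>K / (1 + |\<omega>|)\<close> there, and the claim
  follows by dominated convergence as \<open>\<beta> \<rightarrow> 0\<close>.\<close>

section \<open>Rational functions vanishing at infinity\<close>

lemma poly_tendsto_0_at_infinity_imp_eq_0: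
  fixes p :: "'a::real_normed_field poly"
  assumes "(poly p \<longlongrightarrow> 0) at_infinity"
  shows "p = 0"
proof (cases "degree p = 0")
  case True
  then obtain c where c: "p = [:c:]" by (rule degree_eq_zeroE)
  then have "poly p = (\<lambda>_. c)" by (simp add: fun_eq_iff)
  then show ?thesis using assms c tendsto_const_iff[OF trivial_limit_at_infinity] by auto
next
  case False
  then have "filterlim (poly p) at_infinity at_infinity"
    by (simp add: filterlim_poly_at_infinity)
  with assms show ?thesis
    using not_tendsto_and_filterlim_at_infinity[OF trivial_limit_at_infinity] by blast
qed

lemma eventually_poly_nonzero_at_infinity:
  fixes p :: "'a::real_normed_field poly"
  assumes "p \<noteq> 0"
  shows "eventually (\<lambda>z. poly p z \<noteq> 0) at_infinity"
proof -
  have "bounded {z. poly p z = 0}" by (simp add: finite_imp_bounded poly_roots_finite assms)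
  then obtain b where "\<And>z. poly p z = 0 \<Longrightarrow> norm z \<le> b" by (auto simp: bounded_iff)
  then show ?thesis by (intro eventually_at_infinityI[of "b + 1"]) fastforce
qed

text \<open>Division with remainder splits the quotient into a polynomial and a fraction that
  vanishes at infinity. The assumed limit forces the polynomial part to be zero, so multiplying by z
  raises the numerator's degree at most to that of \<open>q\<close>, and the new fraction still
  converges.\<close>

lemma tendsto_mult_poly_divide:
  fixes p q :: "'a::real_normed_field poly"
  assumes q: "q \<noteq> 0" and lim: "((\<lambda>z. poly p z / poly q z) \<longlongrightarrow> 0) at_infinity"
  shows "\<exists>c. ((\<lambda>z. z * (poly p z / poly q z)) \<longlongrightarrow> c) at_infinity"
proof -
  have rem: "((\<lambda>z. poly (r mod q) z / poly q z) \<longlongrightarrow> 0) at_infinity" for r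
  proof (cases "r mod q = 0")
    case False
    then show ?thesis
      using degree_mod_less[OF q, of r] by (intro poly_divide_tendsto_0_at_infinity) auto
  qed simp
  have split: "eventually (\<lambda>z. poly r z / poly q z
      = poly (r div q) z + poly (r mod q) z / poly q z) at_infinity" for r
    using eventually_poly_nonzero_at_infinity[OF q]
  proof eventually_elim
    case (elim z)
    have "poly r z = poly (r div q) z * poly q z + poly (r mod q) z"
      by (metis div_mult_mod_eq poly_add poly_mult)
    with elim show ?case by (simp add: add_divide_distrib)
  qed
  have "((\<lambda>z. poly p z / poly q z - poly (p mod q) z / poly q z) \<longlongrightarrow> 0 - 0) at_infinity"
    by (intro tendsto_diff lim rem)
  moreover have "eventually (\<lambda>z. poly p z / poly q z - poly (p mod q) z / poly q z
      = poly (p div q) z) at_infinity"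
    using split[of p] by eventually_elim simp
  ultimately have "(poly (p div q) \<longlongrightarrow> 0) at_infinity"
    using Lim_transform_eventually by fastforce
  then have "p div q = 0" by (rule poly_tendsto_0_at_infinity_imp_eq_0)
  then have p: "p = p mod q" by (metis add_0 div_mult_mod_eq mult_zero_left)
  \<comment> \<open>\<open>pCons 0 p\<close> represents z * p(z). Its degree bound makes the
    quotient by \<open>q\<close> a constant, which is the limit sought.\<close>
  have deg: "degree (pCons 0 p) \<le> degree q"
  proof (cases "p = 0")
    case False
    then show ?thesis using degree_mod_less[OF q, of p] p by auto
  qed simp
  have "degree (pCons 0 p div q) = 0"
  proof (rule ccontr)
    let ?d = "pCons 0 p div q" and ?r = "pCons 0 p mod q"
    assume d: "degree ?d \<noteq> 0"
    then have dq: "degree (?d * q) = degree ?d + degree q"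
      using q by (intro degree_mult_eq) auto
    \<comment> \<open>The inequality is weak because for constant \<open>q\<close> the remainder is
      0, whose degree is 0 by convention. Since \<open>?d\<close> has positive degree,
      \<open>?d * q\<close> still dominates \<open>?r\<close>.\<close>
    have "degree ?r \<le> degree q"
      using degree_mod_less[OF q, of "pCons 0 p"] by auto
    then have "degree (?d * q + ?r) = degree (?d * q)"
      using d by (intro degree_add_eq_left) (simp add: dq)
    then have "degree (pCons 0 p) = degree ?d + degree q" by (simp only: div_mult_mod_eq dq)
    with d deg show False by simp
  qed
  then obtain c where c: "pCons 0 p div q = [:c:]" by (rule degree_eq_zeroE)
  have "((\<lambda>z. c + poly (pCons 0 p mod q) z / poly q z) \<longlongrightarrow> c + 0) at_infinity"
    by (intro tendsto_add tendsto_const rem)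
  moreover have "eventually (\<lambda>z. c + poly (pCons 0 p mod q) z / poly q z
      = z * (poly p z / poly q z)) at_infinity"
    using split[of "pCons 0 p"] by eventually_elim (simp add: c)
  ultimately show ?thesis by (intro exI) (rule Lim_transform_eventually)
qed

text \<open>Outside a large disc the bound comes from convergence of z * f(z) at infinity; inside
  it, from continuity on the compact part of \<open>S\<close>, which contains no zero of the
  denominator.\<close>

lemma rational_decay:
  fixes p q :: "complex poly"
  assumes S: "closed S" and nz: "\<And>z. z \<in> S \<Longrightarrow> poly q z \<noteq> 0" and q: "q \<noteq> 0"
    and lim: "((\<lambda>z. poly p z / poly q z) \<longlongrightarrow> 0) at_infinity"
  shows "\<exists>K. \<forall>z\<in>S. cmod (poly p z / poly q z) * (1 + cmod z) \<le> K"
proof -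
  let ?f = "\<lambda>z. poly p z / poly q z"
  let ?g = "\<lambda>z. cmod (?f z) * (1 + cmod z)"
  obtain c where c: "((\<lambda>z. z * ?f z) \<longlongrightarrow> c) at_infinity"
    using tendsto_mult_poly_divide[OF q lim] by blast
  have "((\<lambda>z. cmod (?f z) + cmod (z * ?f z)) \<longlongrightarrow> cmod 0 + cmod c) at_infinity"
    by (intro tendsto_add tendsto_norm lim c)
  then have "eventually (\<lambda>z. cmod (?f z) + cmod (z * ?f z) < cmod 0 + cmod c + 1) at_infinity"
    by (rule order_tendstoD) simp
  then obtain R where R: "\<And>z. R \<le> cmod z \<Longrightarrow> cmod (?f z) + cmod (z * ?f z) < cmod c + 1"
    by (auto simp: eventually_at_infinity)
  have "compact (S \<inter> cball 0 R)" using S by (simp add: closed_Int_compact)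
  moreover have "continuous_on (S \<inter> cball 0 R) ?g"
    by (intro continuous_intros) (use nz in auto)
  ultimately have "bounded (?g ` (S \<inter> cball 0 R))"
    by (intro compact_imp_bounded compact_continuous_image)
  then obtain K where K: "\<And>z. z \<in> S \<inter> cball 0 R \<Longrightarrow> ?g z \<le> K"
    unfolding bounded_real by fastforce
  have "?g z \<le> max K (cmod c + 1)" if "z \<in> S" for z
  proof (cases "cmod z \<le> R")
    case True
    then show ?thesis using K[of z] that by auto
  next
    case False
    have "?g z = cmod (?f z) + cmod (z * ?f z)"
      unfolding norm_mult by (simp only: distrib_left mult_1_right mult.commute[of "cmod z"])
    also have "\<dots> < cmod c + 1" using R False by simp
    finally show ?thesis by simp
  qed
  then show ?thesis by blast
qed

section \<open>Transfer functions\<close>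

lemma matrix_inv_eqI:
  fixes M N :: "'a::field^'n^'n"
  assumes "M ** N = mat 1"
  shows "matrix_inv M = N"
proof -
  have *: "N ** M = mat 1" using assms by (simp add: matrix_left_right_inverse)
  have "M ** matrix_inv M = mat 1 \<and> matrix_inv M ** M = mat 1"
    unfolding matrix_inv_def by (rule someI[where x = N]) (simp add: assms *)
  then show ?thesis
    by (metis * matrix_mul_assoc matrix_mul_lid matrix_mul_rid)
qed

lemma matrix_inv_mul:
  fixes M :: "'a::field^'n^'n"
  assumes "det M \<noteq> 0"
  shows "M ** matrix_inv M = mat 1"
  using assms matrix_inv_eqI by (metis invertible_det_nz invertible_def)

text \<open>The j-th column of the inverse solves M x = e_j, so Cramer's rule gives its
  entries.\<close>

lemma matrix_inv_cramer:
  fixes M :: "'a::field^'n^'n"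
  assumes "det M \<noteq> 0"
  shows "matrix_inv M $ k $ j = det (\<chi> a b. if b = k then mat 1 $ a $ j else M $ a $ b) / det M"
proof -
  have "M *v column j (matrix_inv M) = column j (mat 1)"
    by (simp flip: matrix_inv_mul[OF assms]
          add: vec_eq_iff matrix_vector_mult_def matrix_matrix_mult_def column_def)
  then have "column j (matrix_inv M)
      = (\<chi> k. det (\<chi> a b. if b = k then column j (mat 1) $ a else M $ a $ b) / det M)"
    using cramer[OF assms] by blast
  then have "column j (matrix_inv M) $ k
      = det (\<chi> a b. if b = k then column j (mat 1) $ a else M $ a $ b) / det M"
    by simp
  then show ?thesis by (simp add: column_def cong: if_cong)
qed

lemma poly_det:
  fixes M :: "'a::comm_ring_1 poly^'n^'n"
  shows "poly (det M) s = det (map_matrix (\<lambda>p. poly p s) M)"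
  by (simp add: det_def poly_sum poly_prod)

text \<open>Working over the polynomial ring turns determinants into polynomials in s. Evaluation at
  a point commutes with them, which gives access to finiteness of roots and degree
  arguments.\<close>

definition pencil_poly :: "real^'n^'n \<Rightarrow> real^'n^'n \<Rightarrow> complex poly^'n^'n" where
  "pencil_poly E A = (\<chi> i j. [:- complex_of_real (A $ i $ j), complex_of_real (E $ i $ j):])"

lemma poly_pencil_poly: "poly (pencil_poly E A $ i $ j) s = pencil E A s $ i $ j"
  by (simp add: pencil_poly_def pencil_def)

lemma poly_det_pencil_poly: "poly (det (pencil_poly E A)) s = det (pencil E A s)"
  unfolding poly_det by (rule arg_cong[of _ _ det]) (simp add: vec_eq_iff poly_pencil_poly)

text \<open>The point is that one polynomial serves all s: by Cramer's rule each numerator of the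
  inverse is the determinant of a polynomial matrix, evaluated at s. The constant matrices
  \<open>C\<close> and \<open>B\<close> only form linear combinations of these numerators.\<close>

lemma transfer_function_rational:
  fixes E A :: "real^'n^'n" and B :: "real^'m^'n" and C :: "real^'n^'p"
  shows "\<exists>p. \<forall>s. det (pencil E A s) \<noteq> 0 \<longrightarrow>
    transfer_function E A B C s $ i $ j = poly p s / det (pencil E A s)"
proof -
  define N where
    "N = (\<lambda>k l. det (\<chi> a b. if b = k then mat 1 $ a $ l else pencil_poly E A $ a $ b))"
  have N: "matrix_inv (pencil E A s) $ k $ l = poly (N k l) s / det (pencil E A s)"
    if "det (pencil E A s) \<noteq> 0" for s k l
  proof -
    have "map_matrix (\<lambda>p. poly p s) (\<chi> a b. if b = k then mat 1 $ a $ l else pencil_poly E A $ a $ b)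
        = (\<chi> a b. if b = k then mat 1 $ a $ l else pencil E A s $ a $ b)"
      by (simp add: vec_eq_iff poly_pencil_poly mat_def)
    then show ?thesis by (simp add: matrix_inv_cramer[OF that] N_def poly_det)
  qed
  define p where "p = (\<Sum>l\<in>UNIV. (\<Sum>k\<in>UNIV. [:complex_of_real (C $ i $ k):] * N k l)
    * [:complex_of_real (B $ l $ j):])"
  have "transfer_function E A B C s $ i $ j = poly p s / det (pencil E A s)"
    if "det (pencil E A s) \<noteq> 0" for s
    by (simp add: transfer_function_def matrix_matrix_mult_def N[OF that] p_def poly_sum
        sum_divide_distrib sum_distrib_right sum_distrib_left mult_ac)
  then show ?thesis by blast
qed

section \<open>Poles and decay of transfer functions\<close>

lemma norm_matrix_le_sum:
  fixes M :: "'a::real_normed_vector^'m^'p"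
  shows "norm M \<le> (\<Sum>i\<in>UNIV. \<Sum>j\<in>UNIV. norm (M $ i $ j))"
proof -
  have "norm M \<le> (\<Sum>i\<in>UNIV. norm (M $ i))"
    unfolding norm_vec_def by (rule L2_set_le_sum) simp
  also have "\<dots> \<le> (\<Sum>i\<in>UNIV. \<Sum>j\<in>UNIV. norm (M $ i $ j))"
    by (intro sum_mono) (auto simp: norm_vec_def intro: L2_set_le_sum)
  finally show ?thesis .
qed

lemma norm_matrix_divide:
  fixes M :: "'a::real_normed_field^'m^'p"
  shows "norm (\<chi> i j. M $ i $ j / c) = norm M / norm c"
  by (simp add: norm_vec_def L2_set_def norm_divide power_divide sum_nonneg real_sqrt_divide
      flip: sum_divide_distrib)

text \<open>The eigenvalues are finitely many and lie in the open left half-plane, so they keep a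
  positive distance from the imaginary axis.\<close>

lemma stable_pencil_half_plane:
  assumes "stable_pencil E A"
  shows "\<exists>\<delta>>0. \<forall>s. - \<delta> \<le> Re s \<longrightarrow> det (pencil E A s) \<noteq> 0"
proof -
  let ?q = "det (pencil_poly E A)"
  \<comment> \<open>Stability rules out the root 0, so the determinant is a nonzero polynomial with
    finitely many roots.\<close>
  have "poly ?q 0 \<noteq> 0"
    using assms by (auto simp: stable_pencil_def poly_det_pencil_poly)
  then have fin: "finite {s. poly ?q s = 0}" by (metis poly_0 poly_roots_finite)
  \<comment> \<open>Inserting 1 keeps the set nonempty when there are no eigenvalues; halving the
    minimum excludes roots on the boundary line as well.\<close>
  define \<delta> where "\<delta> = Min (insert 1 ((\<lambda>s. - Re s) ` {s. poly ?q s = 0})) / 2"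
  have pos: "\<delta> > 0"
    using assms fin by (auto simp: \<delta>_def stable_pencil_def poly_det_pencil_poly)
  have "det (pencil E A s) \<noteq> 0" if "- \<delta> \<le> Re s" for s
  proof
    assume "det (pencil E A s) = 0"
    then have "2 * \<delta> \<le> - Re s"
      using fin by (simp add: \<delta>_def poly_det_pencil_poly Min_le)
    with that pos show False by simp
  qed
  with pos show ?thesis by blast
qed

lemma transfer_function_decay:
  fixes E A :: "real^'n^'n" and B :: "real^'m^'n" and C :: "real^'n^'p"
  assumes S: "closed S" and nz: "\<And>s. s \<in> S \<Longrightarrow> det (pencil E A s) \<noteq> 0"
    and reg: "regular_pencil E A" and lim: "strictly_proper (transfer_function E A B C)"
  shows "\<exists>K. \<forall>s\<in>S. norm (transfer_function E A B C s) * (1 + cmod s) \<le> K"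
    and "continuous_on S (transfer_function E A B C)"
proof -
  let ?H = "transfer_function E A B C"
  let ?q = "det (pencil_poly E A)"
  have q: "?q \<noteq> 0"
    using reg by (metis poly_0 poly_det_pencil_poly regular_pencil_def)
  obtain p where p: "\<And>i j s. poly ?q s \<noteq> 0 \<Longrightarrow> ?H s $ i $ j = poly (p i j) s / poly ?q s"
    using transfer_function_rational[of E A B C] unfolding poly_det_pencil_poly by metis
  \<comment> \<open>The formula may fail at eigenvalues, where \<open>matrix_inv\<close> is
    unspecified, but these lie in a bounded set and do not affect limits at infinity.\<close>
  have ev: "eventually (\<lambda>s. ?H s $ i $ j = poly (p i j) s / poly ?q s) at_infinity" for i j
    using eventually_poly_nonzero_at_infinity[OF q] by eventually_elim (rule p)
  have "((\<lambda>s. ?H s $ i $ j) \<longlongrightarrow> 0) at_infinity" for i j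
    using tendsto_vec_nth[OF tendsto_vec_nth[OF lim[unfolded strictly_proper_def]]] by simp
  then have "((\<lambda>s. poly (p i j) s / poly ?q s) \<longlongrightarrow> 0) at_infinity" for i j
    by (rule Lim_transform_eventually[OF _ ev])
  then have "\<exists>K. \<forall>s\<in>S. cmod (poly (p i j) s / poly ?q s) * (1 + cmod s) \<le> K" for i j
    by (intro rational_decay S q) (use nz in \<open>simp_all add: poly_det_pencil_poly\<close>)
  then obtain K where
    K: "\<And>i j s. s \<in> S \<Longrightarrow> cmod (poly (p i j) s / poly ?q s) * (1 + cmod s) \<le> K i j"
    by metis
  have "norm (?H s) * (1 + cmod s) \<le> (\<Sum>i\<in>UNIV. \<Sum>j\<in>UNIV. K i j)" if s: "s \<in> S" for s
  proof -
    have "norm (?H s) * (1 + cmod s) \<le> (\<Sum>i\<in>UNIV. \<Sum>j\<in>UNIV. norm (?H s $ i $ j)) * (1 + cmod s)"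
      by (intro mult_right_mono norm_matrix_le_sum) simp
    also have "\<dots> = (\<Sum>i\<in>UNIV. \<Sum>j\<in>UNIV. norm (?H s $ i $ j) * (1 + cmod s))"
      by (simp add: sum_distrib_right)
    also have "\<dots> \<le> (\<Sum>i\<in>UNIV. \<Sum>j\<in>UNIV. K i j)"
      using K[OF s] p[of s] nz[OF s] by (intro sum_mono) (simp add: poly_det_pencil_poly)
    finally show ?thesis .
  qed
  then show "\<exists>K. \<forall>s\<in>S. norm (?H s) * (1 + cmod s) \<le> K" by blast
  have "continuous_on S (\<lambda>s. \<chi> i j. poly (p i j) s / poly ?q s)"
    by (intro continuous_intros) (use nz in \<open>auto simp: poly_det_pencil_poly\<close>)
  moreover have "?H s = (\<chi> i j. poly (p i j) s / poly ?q s)" if "s \<in> S" for s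
    using p nz[OF that] by (simp add: vec_eq_iff poly_det_pencil_poly)
  ultimately show "continuous_on S ?H" by (simp cong: continuous_on_cong)
qed

section \<open>The Moebius substitution linking the two transfer functions\<close>

lemma transfer_function_moebius:
  fixes E A :: "real^'n^'n" and B :: "real^'m^'n" and C :: "real^'n^'p"
  defines "c \<equiv> \<lambda>\<beta> s. 1 + complex_of_real (\<beta>\<^sup>2) * s"
  assumes c: "c \<beta> s \<noteq> 0"
    and nz: "det (pencil E A ((s - \<beta>) / c \<beta> s)) \<noteq> 0"
  shows "transfer_function (E - \<beta>\<^sup>2 *\<^sub>R A) (A + \<beta> *\<^sub>R E) B C s
    = (\<chi> i j. transfer_function E A B C ((s - \<beta>) / c \<beta> s) $ i $ j / c \<beta> s)"
proof -
  let ?z = "(s - \<beta>) / c \<beta> s"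
  let ?P = "pencil E A ?z"
  \<comment> \<open>The regularised pencil at \<open>s\<close> is \<open>c \<beta> s\<close> times
    \<open>?P\<close>, so its inverse is that of \<open>?P\<close> divided by this scalar.\<close>
  define I where "I = (\<chi> i j. matrix_inv ?P $ i $ j / c \<beta> s)"
  have "pencil (E - \<beta>\<^sup>2 *\<^sub>R A) (A + \<beta> *\<^sub>R E) s $ i $ j = c \<beta> s * ?P $ i $ j" for i j
  proof -
    have "c \<beta> s * ?P $ i $ j
        = (c \<beta> s * ?z) * complex_of_real (E $ i $ j) - c \<beta> s * complex_of_real (A $ i $ j)"
      by (simp only: pencil_def vec_lambda_beta right_diff_distrib mult.assoc)
    also have "c \<beta> s * ?z = s - \<beta>" using c by simp
    finally show ?thesis by (simp add: pencil_def c_def algebra_simps)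
  qed
  then have "pencil (E - \<beta>\<^sup>2 *\<^sub>R A) (A + \<beta> *\<^sub>R E) s ** I = ?P ** matrix_inv ?P"
    using c by (simp add: vec_eq_iff matrix_matrix_mult_def I_def)
  then have "matrix_inv (pencil (E - \<beta>\<^sup>2 *\<^sub>R A) (A + \<beta> *\<^sub>R E) s) = I"
    by (intro matrix_inv_eqI) (simp add: matrix_inv_mul[OF nz])
  then show ?thesis
    by (simp add: transfer_function_def I_def vec_eq_iff matrix_matrix_mult_def
        sum_divide_distrib sum_distrib_right sum_distrib_left)
qed

text \<open>Multiplying by the conjugate denominator gives the real part \<open>(- \<beta> +
  \<beta>\<^sup>2 * \<omega>\<^sup>2) / (1 + (\<beta>\<^sup>2 * \<omega>)\<^sup>2)\<close>. After
  clearing the denominator, the claim says that a sum of nonnegative terms is nonnegative.\<close>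

lemma Re_moebius_imaginary_ge:
  fixes \<beta> \<omega> :: real
  assumes "\<beta> \<ge> 0"
  shows "- \<beta> \<le> Re ((\<i> * \<omega> - \<beta>) / (1 + complex_of_real (\<beta>\<^sup>2) * (\<i> * \<omega>)))"
proof -
  have pos: "1 + (\<beta>\<^sup>2 * \<omega>)\<^sup>2 > 0" by (simp add: add_pos_nonneg)
  have "- \<beta> * (1 + (\<beta>\<^sup>2 * \<omega>)\<^sup>2) \<le> - \<beta> + \<beta>\<^sup>2 * \<omega>\<^sup>2"
    using assms by (simp add: algebra_simps)
      (rule order_trans[of _ 0]; simp)
  then have "- \<beta> \<le> (- \<beta> + \<beta>\<^sup>2 * \<omega>\<^sup>2) / (1 + (\<beta>\<^sup>2 * \<omega>)\<^sup>2)"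
    using pos by (simp add: pos_le_divide_eq)
  also have "\<dots> = Re ((\<i> * \<omega> - \<beta>) / (1 + complex_of_real (\<beta>\<^sup>2) * (\<i> * \<omega>)))"
    by (simp add: Re_divide power2_eq_square algebra_simps)
  finally show ?thesis .
qed

section \<open>Dominated convergence for the error integral\<close>

lemma integrable_inverse_one_plus_square:
  "integrable lborel (\<lambda>x::real. inverse (1 + x\<^sup>2))"
  using integrable_inverse_1_plus_square by (simp add: set_integrable_def)

theorem theorem4:
  fixes E A :: "real^'n^'n"
    and B :: "real^'m^'n"
    and C :: "real^'n^'p"
  assumes "\<not> invertible E"
    and "regular_pencil E A"
    and "stable_pencil E A"
    and "strictly_proper (transfer_function E A B C)"
  shows "\<forall>\<epsilon>>0. \<exists>L>0. \<forall>\<beta>::real. 0 < \<beta> \<and> \<beta> < L \<longrightarrow>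
    (let \<alpha> = \<beta>\<^sup>2;
         E' = E - \<alpha> *\<^sub>R A;
         A' = A + \<beta> *\<^sub>R E;
         H_DAE = transfer_function E A B C;
         H_ODE = transfer_function E' A' B C
     in h2_norm_exists (\<lambda>s. H_DAE s - H_ODE s) \<and> h2_norm (\<lambda>s. H_DAE s - H_ODE s) < \<epsilon>)"
proof -
  define H where "H = transfer_function E A B C"
  obtain \<delta> where \<delta>: "\<delta> > 0" and nz: "\<And>s. - \<delta> \<le> Re s \<Longrightarrow> det (pencil E A s) \<noteq> 0"
    using stable_pencil_half_plane[OF assms(3)] by blast
  \<comment> \<open>This half-plane contains the imaginary axis and, for 0 \<le> \<beta> < \<delta>,
    all Moebius images of it, so a single decay constant \<open>K\<close> controls both transfer
    functions.\<close>
  define S where "S = {s. - \<delta> \<le> Re s}"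
  have S: "closed S" unfolding S_def by (rule closed_halfspace_Re_ge)
  have nzS: "\<And>s. s \<in> S \<Longrightarrow> det (pencil E A s) \<noteq> 0" by (simp add: S_def nz)
  obtain K where K: "\<And>s. s \<in> S \<Longrightarrow> norm (H s) * (1 + cmod s) \<le> K"
    using transfer_function_decay(1)[OF S nzS assms(2,4)] unfolding H_def by blast
  have cont: "continuous_on S H"
    unfolding H_def by (rule transfer_function_decay(2)[OF S nzS assms(2,4)])
  have im: "\<i> * complex_of_real \<omega> \<in> S" for \<omega> using \<delta> by (simp add: S_def)

  define G where
    "G \<beta> = transfer_function (E - \<beta>\<^sup>2 *\<^sub>R A) (A + \<beta> *\<^sub>R E) B C" for \<beta> :: real
  define c where "c \<beta> \<omega> = 1 + complex_of_real (\<beta>\<^sup>2) * (\<i> * complex_of_real \<omega>)" for \<beta> \<omega> :: real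
  define z where "z \<beta> \<omega> = (\<i> * complex_of_real \<omega> - \<beta>) / c \<beta> \<omega>" for \<beta> \<omega> :: real
  \<comment> \<open>The real part of \<open>c \<beta> \<omega>\<close> is exactly 1.\<close>
  have c_ge: "1 \<le> cmod (c \<beta> \<omega>)" for \<beta> \<omega>
    using abs_Re_le_cmod[of "c \<beta> \<omega>"] by (simp add: c_def)
  then have c0: "c \<beta> \<omega> \<noteq> 0" for \<beta> \<omega>
    by (metis norm_zero not_one_le_zero)
  have zS: "z \<beta> \<omega> \<in> S" if "0 \<le> \<beta>" "\<beta> < \<delta>" for \<beta> \<omega>
    using Re_moebius_imaginary_ge[OF that(1), of \<omega>] that(2) unfolding S_def z_def c_def by simp
  have G: "G \<beta> (\<i> * \<omega>) = (\<chi> i j. H (z \<beta> \<omega>) $ i $ j / c \<beta> \<omega>)" if "0 < \<beta>" "\<beta> < \<delta>" for \<beta> \<omega>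
    unfolding G_def H_def z_def c_def
    by (rule transfer_function_moebius) (use c0 nzS[OF zS[of \<beta> \<omega>]] that in \<open>simp_all add: c_def z_def\<close>)

  define F where "F \<beta> \<omega> = (norm (H (\<i> * \<omega>) - G \<beta> (\<i> * \<omega>)))\<^sup>2" for \<beta> \<omega> :: real
  have H_le: "norm (H (\<i> * \<omega>)) * (1 + \<bar>\<omega>\<bar>) \<le> K" for \<omega> :: real
    using K[OF im[of \<omega>]] by (simp add: norm_mult)
  have G_le: "norm (G \<beta> (\<i> * \<omega>)) * (1 + \<bar>\<omega>\<bar>) \<le> K" if \<beta>: "0 < \<beta>" "\<beta> < \<delta>" for \<beta> \<omega>
  proof -
    have "G \<beta> (\<i> * \<omega>) = (\<chi> i j. H (z \<beta> \<omega>) $ i $ j / c \<beta> \<omega>)" by (rule G[OF \<beta>])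
    then have "norm (G \<beta> (\<i> * \<omega>)) = norm (H (z \<beta> \<omega>)) / cmod (c \<beta> \<omega>)"
      by (simp only: norm_matrix_divide)
    \<comment> \<open>The product is the modulus of the numerator of \<open>z\<close>, whose
      imaginary part is \<omega>.\<close>
    moreover have "cmod (z \<beta> \<omega>) * cmod (c \<beta> \<omega>) \<ge> \<bar>\<omega>\<bar>"
      using c0[of \<beta> \<omega>] abs_Im_le_cmod[of "\<i> * complex_of_real \<omega> - \<beta>"]
      by (simp add: z_def norm_divide)
    then have "1 + \<bar>\<omega>\<bar> \<le> (1 + cmod (z \<beta> \<omega>)) * cmod (c \<beta> \<omega>)"
      using c_ge[of \<beta> \<omega>] by (simp add: distrib_right)
    then have "norm (H (z \<beta> \<omega>)) / cmod (c \<beta> \<omega>) * (1 + \<bar>\<omega>\<bar>)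
        \<le> norm (H (z \<beta> \<omega>)) / cmod (c \<beta> \<omega>) * ((1 + cmod (z \<beta> \<omega>)) * cmod (c \<beta> \<omega>))"
      by (rule mult_left_mono) simp
    moreover have "\<dots> = norm (H (z \<beta> \<omega>)) * (1 + cmod (z \<beta> \<omega>))"
      using c0[of \<beta> \<omega>] by simp
    ultimately show ?thesis using K[OF zS[of \<beta> \<omega>]] \<beta> by simp
  qed
  \<comment> \<open>The triangle inequality bounds the error by 2K / (1 + |\<omega>|). Squaring and
    using \<open>(1 + \<bar>\<omega>\<bar>)\<^sup>2 \<ge> 1 + \<omega>\<^sup>2\<close> gives an
    integrable majorant independent of \<beta>.\<close>
  have F_le: "norm (F \<beta> \<omega>) \<le> (2 * K)\<^sup>2 * inverse (1 + \<omega>\<^sup>2)" if \<beta>: "0 < \<beta>" "\<beta> < \<delta>" for \<beta> \<omega>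
  proof -
    let ?n = "norm (H (\<i> * \<omega>) - G \<beta> (\<i> * \<omega>))"
    have "?n * (1 + \<bar>\<omega>\<bar>) \<le> (norm (H (\<i> * \<omega>)) + norm (G \<beta> (\<i> * \<omega>))) * (1 + \<bar>\<omega>\<bar>)"
      by (intro mult_right_mono norm_triangle_ineq4) simp
    also have "\<dots> \<le> 2 * K" using H_le[of \<omega>] G_le[OF \<beta>, of \<omega>] by (simp add: distrib_right)
    finally have "(?n * (1 + \<bar>\<omega>\<bar>))\<^sup>2 \<le> (2 * K)\<^sup>2" by (rule power_mono) simp
    moreover have "?n\<^sup>2 * (1 + \<omega>\<^sup>2) \<le> (?n * (1 + \<bar>\<omega>\<bar>))\<^sup>2"
      unfolding power_mult_distrib by (intro mult_left_mono) (auto simp: power2_sum)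
    ultimately have "?n\<^sup>2 * (1 + \<omega>\<^sup>2) \<le> (2 * K)\<^sup>2" by linarith
    then have "?n\<^sup>2 \<le> (2 * K)\<^sup>2 / (1 + \<omega>\<^sup>2)"
      by (subst pos_le_divide_eq) (simp_all add: add_pos_nonneg)
    then show ?thesis by (simp add: F_def divide_inverse)
  qed
  have dom: "integrable lborel (\<lambda>\<omega>. (2 * K)\<^sup>2 * inverse (1 + \<omega>\<^sup>2))"
    by (intro integrable_mult_right integrable_inverse_one_plus_square)
  have H_cont: "continuous_on UNIV (\<lambda>\<omega>::real. H (\<i> * \<omega>))"
    by (rule continuous_on_compose2[OF cont]) (use im in \<open>auto intro!: continuous_intros\<close>)
  have F_meas: "F \<beta> \<in> borel_measurable lborel" if \<beta>: "0 < \<beta>" "\<beta> < \<delta>" for \<beta>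
  proof -
    have Hz: "continuous_on UNIV (\<lambda>\<omega>. H (z \<beta> \<omega>))"
      by (rule continuous_on_compose2[OF cont])
        (use zS \<beta> c0 in \<open>auto simp: z_def c_def intro!: continuous_intros\<close>)
    have "continuous_on UNIV (c \<beta>)"
      unfolding c_def by (intro continuous_intros)
    then have "continuous_on UNIV (\<lambda>\<omega>. \<chi> i j. H (z \<beta> \<omega>) $ i $ j / c \<beta> \<omega>)"
      by (intro continuous_intros Hz) (use c0 in auto)
    then have "continuous_on UNIV (F \<beta>)"
      \<comment> \<open>Continuity of \<open>G\<close> along the axis is read off from its Moebius
        form, avoiding any continuity argument for \<open>matrix_inv\<close>.\<close>
      unfolding F_def G[OF \<beta>]
      by (intro continuous_on_power continuous_on_norm continuous_on_diff H_cont)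
    then show ?thesis by (simp add: borel_measurable_continuous_onI)
  qed
  have F_int: "integrable lborel (F \<beta>)" if \<beta>: "0 < \<beta>" "\<beta> < \<delta>" for \<beta>
  proof (rule Bochner_Integration.integrable_bound[OF dom F_meas[OF \<beta>]])
    show "AE \<omega> in lborel. norm (F \<beta> \<omega>) \<le> norm ((2 * K)\<^sup>2 * inverse (1 + \<omega>\<^sup>2))"
      unfolding real_norm_def
      by (intro AE_I2 order_trans[OF F_le[OF \<beta>, unfolded real_norm_def] abs_ge_self])
  qed
  \<comment> \<open>As \<beta> tends to 0, \<open>c\<close> tends to 1 and \<open>z\<close> to
    i\<omega> within \<open>S\<close>; continuity of \<open>H\<close> on \<open>S\<close> then gives
    pointwise convergence.\<close>
  have F_lim: "(\<lambda>n. F (b n) \<omega>) \<longlonglongrightarrow> 0"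
    if b: "\<And>n. 0 < b n" "\<And>n. b n < \<delta>" "b \<longlonglongrightarrow> 0" for b :: "nat \<Rightarrow> real" and \<omega>
  proof -
    have c_lim: "(\<lambda>n. c (b n) \<omega>) \<longlonglongrightarrow> 1"
      unfolding c_def by (rule tendsto_eq_intros b(3) refl | simp)+
    have "(\<lambda>n. z (b n) \<omega>) \<longlonglongrightarrow> (\<i> * \<omega> - complex_of_real 0) / 1"
      unfolding z_def by (intro tendsto_intros b(3) c_lim) simp
    then have "(\<lambda>n. z (b n) \<omega>) \<longlonglongrightarrow> \<i> * \<omega>" by simp
    then have "(\<lambda>n. H (z (b n) \<omega>)) \<longlonglongrightarrow> H (\<i> * \<omega>)"
      by (rule continuous_on_tendsto_compose[OF cont]) (use im zS b(1,2) in \<open>auto simp: less_imp_le\<close>)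
    then have "(\<lambda>n. \<chi> i j. H (z (b n) \<omega>) $ i $ j / c (b n) \<omega>)
        \<longlonglongrightarrow> (\<chi> i j. H (\<i> * \<omega>) $ i $ j / 1)"
      by (intro tendsto_intros c_lim) simp_all
    then have "(\<lambda>n. G (b n) (\<i> * \<omega>)) \<longlonglongrightarrow> H (\<i> * \<omega>)" by (simp add: G b(1,2))
    then have "(\<lambda>n. F (b n) \<omega>) \<longlonglongrightarrow> (norm (H (\<i> * \<omega>) - H (\<i> * \<omega>)))\<^sup>2"
      unfolding F_def by (intro tendsto_intros)
    then show ?thesis by simp
  qed
  have lim: "((\<lambda>\<beta>. LINT \<omega>|lborel. F \<beta> \<omega>) \<longlongrightarrow> 0) (at_right 0)"
  \<comment> \<open>Dominated convergence is applied along sequences, which may be confined to (0,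
    \<delta>), where the majorant is valid.\<close>
  proof (rule tendsto_at_right_sequentially[OF \<delta>])
    fix b :: "nat \<Rightarrow> real"
    assume b: "\<And>n. 0 < b n" "\<And>n. b n < \<delta>" "b \<longlonglongrightarrow> 0"
    have "(\<lambda>n. LINT \<omega>|lborel. F (b n) \<omega>) \<longlonglongrightarrow> (LINT \<omega>::real|lborel. 0)"
      by (rule integral_dominated_convergence[OF _ F_meas[OF b(1,2)] dom])
        (simp, (intro AE_I2 F_lim F_le b)+)
    then show "(\<lambda>n. LINT \<omega>|lborel. F (b n) \<omega>) \<longlonglongrightarrow> 0" by simp
  qed
  have "((\<lambda>\<beta>. sqrt (1 / (2 * pi) * (LINT \<omega>|lborel. F \<beta> \<omega>))) \<longlongrightarrow> sqrt (1 / (2 * pi) * 0)) (at_right 0)"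
    by (intro tendsto_intros lim)
  then have lim': "((\<lambda>\<beta>. h2_norm (\<lambda>s. H s - G \<beta> s)) \<longlongrightarrow> 0) (at_right 0)"
    by (simp add: h2_norm_def frobenius_norm_eq_norm F_def)
  show ?thesis
  proof (intro allI impI)
    fix \<epsilon> :: real assume "\<epsilon> > 0"
    then have "eventually (\<lambda>\<beta>. h2_norm (\<lambda>s. H s - G \<beta> s) < \<epsilon>) (at_right 0)"
      by (rule order_tendstoD(2)[OF lim'])
    then obtain L where L: "L > 0" "\<And>\<beta>. 0 < \<beta> \<Longrightarrow> \<beta> < L \<Longrightarrow> h2_norm (\<lambda>s. H s - G \<beta> s) < \<epsilon>"
      by (auto simp: eventually_at_right_field)
    have ex: "h2_norm_exists (\<lambda>s. H s - G \<beta> s)" if "0 < \<beta>" "\<beta> < \<delta>" for \<beta>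
      using F_int[OF that] by (simp add: h2_norm_exists_def frobenius_norm_eq_norm F_def[abs_def])
    show "\<exists>L>0. \<forall>\<beta>. 0 < \<beta> \<and> \<beta> < L \<longrightarrow>
      (let \<alpha> = \<beta>\<^sup>2; E' = E - \<alpha> *\<^sub>R A; A' = A + \<beta> *\<^sub>R E;
           H_DAE = transfer_function E A B C; H_ODE = transfer_function E' A' B C
       in h2_norm_exists (\<lambda>s. H_DAE s - H_ODE s) \<and> h2_norm (\<lambda>s. H_DAE s - H_ODE s) < \<epsilon>)"
      \<comment> \<open>Below \<delta> the norm exists; below \<open>L\<close> it is smaller than
        \<epsilon>.\<close>
      using L \<delta> ex by (intro exI[of _ "min L \<delta>"]) (simp add: Let_def H_def G_def)
  qed
qed

end
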